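(* Given $B\in\mathbb{F}_2^{m\times n}$, let $C=\{B\mathbf{x}:\mathbf{x}\in\mathbb{F}_2^n\}$ and $C^\perp=\{\mathbf{d}\in\mathbb{F}_2^m:B^T\mathbf{d}=\mathbf{0}\}$. Let $P:\mathbb{F}_2^m\to\mathbb{C}$ satisfy $\sum_{\mathbf{x}\in\mathbb{F}_2^m}|P(\mathbf{x})|^2=1$, and let $\widetilde P$ be the Hadamard transform of $P$. Choose $\mathbf{v}\in\mathbb{F}_2^m$ uniformly at random, and apply Regev's reduction to the max-XORSAT problem of finding a codeword $\mathbf{c}\in C$ minimizing $|\mathbf{c}-\mathbf{v}|$ (Hamming weight). Using any quantum algorithm for the quantum decoding problem $\mathrm{QDP}_{C^\perp,\widetilde P}$ succeeding with probability $1-\epsilon$ (where $\epsilon<1$), this procedure produces a codeword $\mathbf{c}\in C$ such that $$\mathbb{E}_{\mathbf{v}}\left[1-\frac{|\mathbf{c}-\mathbf{v}|}{m}\right]\ \ge\ \left[\sum_{\mathbf{y}\in\mathbb{F}_2^m}|P(\mathbf{y})|^2\left(1-\frac{|\mathbf{y}|}{m}\right)\right]-2\sqrt{\epsilon},$$ where the expectation is over uniform $\mathbf{v}$ and over the random output $\mathbf{c}$ of the procedure.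
   Context: Conventions. $|\cdot|$ denotes Hamming weight. On $\mathbb{C}^{2^m}$ with orthonormal basis $\{|\mathbf{x}\rangle\}_{\mathbf{x}\in\mathbb{F}_2^m}$: $H^{\otimes m}|\mathbf{x}\rangle=2^{-m/2}\sum_{\mathbf{y}}(-1)^{\mathbf{x}\cdot\mathbf{y}}|\mathbf{y}\rangle$, $Z^{\mathbf{v}}|\mathbf{x}\rangle=(-1)^{\mathbf{v}\cdot\mathbf{x}}|\mathbf{x}\rangle$. The Hadamard transform is $\widetilde P(\mathbf{e})=2^{-m/2}\sum_{\mathbf{x}}(-1)^{\mathbf{x}\cdot\mathbf{e}}P(\mathbf{x})$. Quantum decoding problem. $\mathrm{QDP}_{C^\perp,\widetilde P}$: given the state $\sum_{\mathbf{e}\in\mathbb{F}_2^m}\widetilde P(\mathbf{e})|\mathbf{d}+\mathbf{e}\rangle$ for uniformly random $\mathbf{d}\in C^\perp$, output $\mathbf{d}$. An algorithm for it is given by a finite-dimensional ancilla space $\mathcal{H}_{\mathrm{anc}}$ with a unit vector $|0_{\mathrm{anc}}\rangle$ and a unitary $U_{\mathrm{dec}}:\mathbb{C}^{2^m}\otimes\mathcal{H}_{\mathrm{anc}}\to\mathcal{G}\otimes\mathbb{C}^{2^m}$ ($\mathcal{G}$ a garbage space), after which the last register is measured in the standard basis. For $\mathbf{d}\in C^\perp$ write $$U_{\mathrm{dec}}\sum_{\mathbf{e}}\widetilde P(\mathbf{e})|\mathbf{d}+\mathbf{e}\rangle|0_{\mathrm{anc}}\rangle=\sqrt{1-\epsilon_{\mathbf{d}}}\,|\xi_{\mathbf{d}}\rangle|\mathbf{d}\rangle+\sqrt{\epsilon_{\mathbf{d}}}\,|\delta_{\mathbf{d}}\rangle,$$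 with $|\xi_{\mathbf{d}}\rangle,|\delta_{\mathbf{d}}\rangle$ unit vectors and $|\delta_{\mathbf{d}}\rangle$ having zero amplitude on states whose last register is $|\mathbf{d}\rangle$. The success probability is $1-\epsilon$ with $\epsilon=\frac{1}{|C^\perp|}\sum_{\mathbf{d}\in C^\perp}\epsilon_{\mathbf{d}}$. Regev's reduction on input $\mathbf{v}$. Prepare $|C^\perp|^{-1/2}\sum_{\mathbf{d}\in C^\perp}|\mathbf{d}\rangle\otimes\sum_{\mathbf{e}}\widetilde P(\mathbf{e})|\mathbf{e}\rangle$; apply $Z^{\mathbf{v}}$ to the first register; add the first register into the second; append $|0_{\mathrm{anc}}\rangle$ and apply $U_{\mathrm{dec}}$ to the second register and ancilla; postselect on the last register being equal to the first (restarting otherwise); subtract the last register from the first and discard the first; apply $U_{\mathrm{dec}}^\dagger$; apply $Z^{\mathbf{v}}$ to the first register. The resulting unit vector is $$|\Phi_{\mathrm{actual}}(\mathbf{v})\rangle=\mathcal{N}_{\mathrm{dec}}\,(Z^{\mathbf{v}}\otimes 1_{\mathrm{anc}})\,U_{\mathrm{dec}}^\dagger\sum_{\mathbf{d}\in C^\perp}(-1)^{\mathbf{v}\cdot\mathbf{d}}\sqrt{1-\epsilon_{\mathbf{d}}}\,|\xi_{\mathbf{d}}\rangle|\mathbf{d}\rangle,$$ with $\mathcal{N}_{\mathrm{dec}}>0$ the normalization constant. Finally apply $H^{\otimes m}$ to the first register and measure it in the standard basis; the output $\mathbf{c}$ is distributed as the measurement outcome conditioned on lying in $C$ (if that event has probability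 zero, $\mathbf{c}$ is an arbitrary element of $C$). *)

theory Defs
  imports "HOL-Probability.Probability" "HOL-Library.Z2"
begin

(* The field with two elements is the library type bit, so vectors of length m are of type
   bit ^ 'm with m = CARD('m). The instance makes bit ^ 'm itself usable as the index type of
   the 2^m-dimensional state space complex ^ (bit ^ 'm). *)

instance bit :: finite
proof
  have "(UNIV :: bit set) = {0, 1}"
    by (auto intro: bit.exhaust)
  then show "finite (UNIV :: bit set)"
    by (metis finite.emptyI finite.insertI)
qed

definition hamming_weight :: "bit ^ 'm \<Rightarrow> nat" where
  "hamming_weight x = card {i. x $ i \<noteq> 0}"

definition code :: "bit ^ 'n ^ 'm \<Rightarrow> (bit ^ 'm) set" where
  "code B = {B *v x |x. True}"

definition dual_code :: "bit ^ 'n ^ 'm \<Rightarrow> (bit ^ 'm) set" where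
  "dual_code B = {d. transpose B *v d = 0}"

definition parity_sign :: "bit ^ 'm \<Rightarrow> bit ^ 'm \<Rightarrow> complex" where
  "parity_sign x y = (if scalar_product x y = 0 then 1 else - 1)"

definition hadamard_transform :: "(bit ^ 'm \<Rightarrow> complex) \<Rightarrow> bit ^ 'm \<Rightarrow> complex" where
  "hadamard_transform P e =
     complex_of_real (1 / sqrt (2 ^ CARD('m))) * (\<Sum>x\<in>UNIV. parity_sign x e * P x)"


(* A register with basis labels in a finite type 'i has state space complex ^ 'i, and a pair of
   registers has labels in 'i \<times> 'j. Operators are matrices; a matrix of type
   complex ^ 'i ^ 'j maps complex ^ 'i to complex ^ 'j. *)

definition ket :: "'i::finite \<Rightarrow> complex ^ 'i" where
  "ket x = axis x 1"

definition tensor_vec :: "complex ^ 'i \<Rightarrow> complex ^ 'j \<Rightarrow> complex ^ ('i::finite \<times> 'j::finite)" where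
  "tensor_vec s t = (\<chi> p. s $ fst p * t $ snd p)"

definition tensor_op ::
    "complex ^ 'i ^ 'k \<Rightarrow> complex ^ 'j ^ 'l
      \<Rightarrow> complex ^ ('i::finite \<times> 'j::finite) ^ ('k::finite \<times> 'l::finite)" where
  "tensor_op A A' = (\<chi> p q. A $ fst p $ fst q * A' $ snd p $ snd q)"

definition hermitian_adjoint :: "complex ^ 'i ^ 'j \<Rightarrow> complex ^ 'j ^ 'i" where
  "hermitian_adjoint A = (\<chi> i j. cnj (A $ j $ i))"

definition unitary :: "complex ^ 'i ^ 'j \<Rightarrow> bool" where
  "unitary A \<longleftrightarrow> hermitian_adjoint A ** A = mat 1 \<and> A ** hermitian_adjoint A = mat 1"

definition basis_map :: "('i::finite \<Rightarrow> 'j::finite) \<Rightarrow> complex ^ 'i ^ 'j" where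
  "basis_map f = (\<chi> j i. if j = f i then 1 else 0)"

definition hadamard_op :: "complex ^ (bit ^ 'm) ^ (bit ^ 'm)" where
  "hadamard_op = (\<chi> y x. complex_of_real (1 / sqrt (2 ^ CARD('m))) * parity_sign x y)"

definition Z_op :: "bit ^ 'm \<Rightarrow> complex ^ (bit ^ 'm) ^ (bit ^ 'm)" where
  "Z_op v = (\<chi> y x. if y = x then parity_sign v x else 0)"

(* Outcome distributions (Born rule) for measuring one of two registers; meaningful for unit
   vectors s, for which the weights add up to 1. *)

definition measure_first :: "complex ^ ('i::finite \<times> 'j::finite) \<Rightarrow> 'i pmf" where
  "measure_first s = embed_pmf (\<lambda>x. \<Sum>a\<in>UNIV. (cmod (s $ (x, a)))\<^sup>2)"

definition measure_last :: "complex ^ ('i::finite \<times> 'j::finite) \<Rightarrow> 'j pmf" where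
  "measure_last s = embed_pmf (\<lambda>x. \<Sum>a\<in>UNIV. (cmod (s $ (a, x)))\<^sup>2)"

definition error_state :: "(bit ^ 'm \<Rightarrow> complex) \<Rightarrow> complex ^ (bit ^ 'm)" where
  "error_state Q = (\<Sum>e\<in>UNIV. Q e *s ket e)"

definition noisy_state :: "(bit ^ 'm \<Rightarrow> complex) \<Rightarrow> bit ^ 'm \<Rightarrow> complex ^ (bit ^ 'm)" where
  "noisy_state Q d = (\<Sum>e\<in>UNIV. Q e *s ket (d + e))"


(* The quantum decoding problem for the code D and error amplitudes Q: an algorithm is a
   unitary U with ancilla state anc; its success probability is the probability that measuring
   the last register returns the uniformly random d in D. *)

definition qdp_success_prob ::
    "(bit ^ 'm) set \<Rightarrow> (bit ^ 'm \<Rightarrow> complex)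
      \<Rightarrow> complex ^ ((bit ^ 'm) \<times> 'a::finite) ^ ('g::finite \<times> (bit ^ 'm)) \<Rightarrow> complex ^ 'a \<Rightarrow> real" where
  "qdp_success_prob D Q U anc =
     measure_pmf.prob
       (do { d \<leftarrow> pmf_of_set D;
             d' \<leftarrow> measure_last (U *v tensor_vec (noisy_state Q d) anc);
             return_pmf (d, d') })
       {(d, d'). d' = d}"


(* Projection onto the states whose first and last registers agree, renormalized;
   sgn s is s / norm s. *)

definition postselect_equal ::
    "complex ^ ('w::finite \<times> ('g::finite \<times> 'w)) \<Rightarrow> complex ^ ('w \<times> ('g \<times> 'w))" where
  "postselect_equal s = sgn (\<chi> p. case p of (x, g, y) \<Rightarrow> if x = y then s $ (x, g, y) else 0)"

(* In s7, discarding the first register amounts to keeping its component at 0, because s6 is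
   supported there. *)

definition regev_state ::
    "bit ^ 'n ^ 'm \<Rightarrow> (bit ^ 'm \<Rightarrow> complex)
      \<Rightarrow> complex ^ ((bit ^ 'm) \<times> 'a::finite) ^ ('g::finite \<times> (bit ^ 'm)) \<Rightarrow> complex ^ 'a
      \<Rightarrow> bit ^ 'm \<Rightarrow> complex ^ ((bit ^ 'm) \<times> 'a)" where
  "regev_state B P U anc v =
    (let D = dual_code B;
         s0 = tensor_vec (complex_of_real (1 / sqrt (card D)) *s (\<Sum>d\<in>D. ket d))
                (error_state (hadamard_transform P));
         s1 = tensor_op (Z_op v) (mat 1) *v s0;
         s2 = basis_map (\<lambda>(x, y). (x, x + y)) *v s1;
         s3 = basis_map (\<lambda>((x, y), a). (x, (y, a))) *v tensor_vec s2 anc;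
         s4 = tensor_op (mat 1) U *v s3;
         s5 = postselect_equal s4;
         s6 = basis_map (\<lambda>(x, g, y). (x - y, g, y)) *v s5;
         s7 = (\<chi> q. s6 $ (0, q));
         s8 = hermitian_adjoint U *v s7
     in tensor_op (Z_op v) (mat 1) *v s8)"

definition regev_outcome ::
    "bit ^ 'n ^ 'm \<Rightarrow> (bit ^ 'm \<Rightarrow> complex)
      \<Rightarrow> complex ^ ((bit ^ 'm) \<times> 'a::finite) ^ ('g::finite \<times> (bit ^ 'm)) \<Rightarrow> complex ^ 'a
      \<Rightarrow> bit ^ 'm \<Rightarrow> (bit ^ 'm) pmf" where
  "regev_outcome B P U anc v =
     measure_first (tensor_op hadamard_op (mat 1) *v regev_state B P U anc v)"

(* The parameter fallback gives the arbitrary codeword, possibly depending on v, that is returned when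
   the measurement yields a codeword with probability 0. *)

definition regev_output ::
    "(bit ^ 'm \<Rightarrow> bit ^ 'm) \<Rightarrow> bit ^ 'n ^ 'm \<Rightarrow> (bit ^ 'm \<Rightarrow> complex)
      \<Rightarrow> complex ^ ((bit ^ 'm) \<times> 'a::finite) ^ ('g::finite \<times> (bit ^ 'm)) \<Rightarrow> complex ^ 'a
      \<Rightarrow> bit ^ 'm \<Rightarrow> (bit ^ 'm) pmf" where
  "regev_output fallback B P U anc v =
     (if measure_pmf.prob (regev_outcome B P U anc v) (code B) = 0 then return_pmf (fallback v)
      else cond_pmf (regev_outcome B P U anc v) (code B))"

end

(* Let psi_d be the decoder's output on the noisy codeword d, and let S_v = |D|^(-1/2) sum_d
   (-1)^(v.d) psi_d with D the dual code. Undoing the decoder on S_v and applying Z^v and the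
   Hadamard transform gives a state whose amplitude at c in C is sqrt |D| P(c + v), so by |C|
   |D| = 2^m it yields exactly the target value on average over v. The reduction uses instead
   the projection K_v of S_v in which every psi_d is restricted to the outcome d; by Parseval
   over v, the mean of |K_v|^2 is 1 - epsilon and the mean of |S_v - K_v|^2 is epsilon. The
   triangle inequality in the L2 space over v and the basis labels then costs at most 2 sqrt
   epsilon, while normalizing K_v and conditioning on the outcome being in C can only increase
   the nonnegative objective. *)

theory Submission
  imports Defs
begin

section \<open>Arithmetic in characteristic 2 and the characters (-1)^(x.y)\<close>

lemma bit_vec_add_self [simp]: "x + x = (0 :: bit ^ 'm)"
  by (simp add: vec_eq_iff)

lemma bit_vec_diff: "x - y = (x + y :: bit ^ 'm)"
  by (simp add: vec_eq_iff)

lemma bit_vec_add_self_left [simp]: "x + (x + y) = (y :: bit ^ 'm)"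
  by (simp flip: add.assoc)

lemma bit_vec_add_self_right [simp]: "(y + x) + x = (y :: bit ^ 'm)"
  by (simp add: add.assoc)

lemma card_bit_vec: "CARD(bit ^ 'm) = 2 ^ CARD('m::finite)"
proof -
  have "(UNIV :: bit set) = {0, 1}"
    by (auto intro: bit.exhaust)
  then have "CARD(bit) = 2"
    by (metis card_2_iff zero_neq_one)
  then show ?thesis
    by (simp only: CARD_vec)
qed

lemma scalar_product_commute: "scalar_product x y = scalar_product y (x :: 'a::comm_semiring_1 ^ 'n)"
  by (simp add: scalar_product_def mult.commute)

lemma scalar_product_add_left:
  "scalar_product (x + y) z = scalar_product x z + scalar_product y (z :: 'a::comm_semiring_1 ^ 'n)"
  by (simp add: scalar_product_def distrib_right sum.distrib)

lemma scalar_product_transpose: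
  fixes A :: "'a::comm_semiring_1 ^ 'n ^ 'm"
  shows "scalar_product x (A *v y) = scalar_product (transpose A *v x) y"
  unfolding scalar_product_def matrix_vector_mult_def transpose_def
  by (simp add: sum_distrib_left sum_distrib_right, subst sum.swap) (simp add: mult_ac)

lemma parity_sign_commute: "parity_sign x y = parity_sign y x"
  by (simp only: parity_sign_def scalar_product_commute)

lemma parity_sign_add_left: "parity_sign (x + y) z = parity_sign x z * parity_sign y z"
  by (cases "scalar_product x z"; cases "scalar_product y z")
    (auto simp: parity_sign_def scalar_product_add_left)

lemma parity_sign_add_right: "parity_sign z (x + y) = parity_sign z x * parity_sign z y"
  by (metis parity_sign_add_left parity_sign_commute)

lemma parity_sign_zero [simp]: "parity_sign 0 x = 1" "parity_sign x 0 = 1"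
  by (simp_all add: parity_sign_def scalar_product_def)

lemma parity_sign_self [simp]: "parity_sign x y * parity_sign x y = 1"
  "parity_sign x y * (parity_sign x y * z) = z"
  by (simp_all add: parity_sign_def)

lemma cnj_parity_sign [simp]: "cnj (parity_sign x y) = parity_sign x y"
  by (simp add: parity_sign_def)

lemma cmod_parity_sign [simp]: "cmod (parity_sign x y) = 1"
  by (simp add: parity_sign_def)

lemma sum_bit_vec_translate:
  fixes f :: "bit ^ 'm::finite \<Rightarrow> 'b::comm_monoid_add"
  shows "(\<Sum>x\<in>UNIV. f (x + a)) = (\<Sum>x\<in>UNIV. f x)"
  by (rule sum.reindex_bij_witness[of _ "\<lambda>x. x + a" "\<lambda>x. x + a"]) auto

text \<open>Translation by \<open>s\<close> is an involution of \<open>S\<close> that flips the sign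
  of every term, so the sum equals its own negative.\<close>

lemma sum_parity_sign_eq_0:
  assumes "\<And>x y. x \<in> S \<Longrightarrow> y \<in> S \<Longrightarrow> x + y \<in> S" "s \<in> S" "parity_sign s d \<noteq> 1"
  shows "(\<Sum>x\<in>S. parity_sign x d) = 0"
proof -
  have s: "parity_sign s d = - 1"
    using assms(3) by (simp add: parity_sign_def split: if_splits)
  have "(\<Sum>x\<in>S. parity_sign x d) = (\<Sum>x\<in>S. parity_sign (x + s) d)"
    using assms(1,2)
    by (intro sum.reindex_bij_witness[of _ "\<lambda>x. x + s" "\<lambda>x. x + s"]) auto
  also have "\<dots> = - (\<Sum>x\<in>S. parity_sign x d)"
    by (simp add: parity_sign_add_left s sum_negf)
  finally show ?thesis
    by simp
qed

text \<open>Character orthogonality: for nonzero \<open>d\<close>, the unit vector at a nonzero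
  coordinate of \<open>d\<close> is the translation that flips all signs.\<close>

lemma sum_parity_sign_UNIV:
  fixes d :: "bit ^ 'm::finite"
  shows "(\<Sum>x\<in>UNIV. parity_sign x d) = (if d = 0 then 2 ^ CARD('m) else 0)"
proof (cases "d = 0")
  case True
  then show ?thesis
    by (simp add: card_bit_vec del: CARD_vec)
next
  case False
  then obtain i where "d $ i = 1"
    by (auto simp: vec_eq_iff bit_not_zero_iff)
  then have "scalar_product (axis i 1) d = 1"
    by (simp add: scalar_product_def axis_def mult_delta_left)
  then show ?thesis
    using False sum_parity_sign_eq_0[of UNIV "axis i 1" d] by (simp add: parity_sign_def)
qed

section \<open>Norms, tensor products and unitary operators on registers\<close>

lemma sum_UNIV_prod:
  "(\<Sum>p\<in>UNIV. f p) = (\<Sum>x\<in>UNIV. \<Sum>y\<in>UNIV. f (x :: 'a::finite, y :: 'b::finite))"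
  by (simp add: sum.cartesian_product)

lemma norm_vec_square: "(norm (x :: complex ^ 'i))\<^sup>2 = (\<Sum>i\<in>UNIV. (cmod (x $ i))\<^sup>2)"
  by (simp add: norm_vec_def L2_set_def sum_nonneg)

lemma norm_vec_scale: "norm (c *s (x :: complex ^ 'i)) = cmod c * norm x"
proof -
  have "(norm (c *s x))\<^sup>2 = (cmod c * norm x)\<^sup>2"
    by (simp add: norm_vec_square power_mult_distrib norm_mult sum_distrib_left)
  then show ?thesis
    by (rule power2_eq_imp_eq) auto
qed

lemma norm_tensor_vec: "norm (tensor_vec s t) = norm s * norm t"
proof -
  have "(norm (tensor_vec s t))\<^sup>2 = (norm s * norm t)\<^sup>2"
    by (simp add: norm_vec_square tensor_vec_def sum_UNIV_prod power_mult_distrib norm_mult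
        sum_product)
  then show ?thesis
    by (rule power2_eq_imp_eq) auto
qed

lemma hermitian_adjoint_hermitian_adjoint [simp]: "hermitian_adjoint (hermitian_adjoint A) = A"
  by (simp add: hermitian_adjoint_def vec_eq_iff)

lemma unitary_hermitian_adjoint: "unitary A \<Longrightarrow> unitary (hermitian_adjoint A)"
  by (simp add: unitary_def)

lemma unitary_mat_1: "unitary (mat 1 :: complex ^ 'i ^ 'i)"
proof -
  have "hermitian_adjoint (mat 1 :: complex ^ 'i ^ 'i) = mat 1"
    by (auto simp: hermitian_adjoint_def mat_def vec_eq_iff)
  then show ?thesis
    by (simp add: unitary_def)
qed

lemma tensor_op_mult: "tensor_op A B ** tensor_op C D = tensor_op (A ** C) (B ** D)"
  by (simp add: tensor_op_def matrix_matrix_mult_def vec_eq_iff sum_UNIV_prod sum_product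
      mult.assoc mult.left_commute)

lemma tensor_op_mat_1: "tensor_op (mat 1) (mat 1) = mat 1"
  by (auto simp: tensor_op_def mat_def vec_eq_iff prod_eq_iff)

lemma hermitian_adjoint_tensor_op:
  "hermitian_adjoint (tensor_op A B) = tensor_op (hermitian_adjoint A) (hermitian_adjoint B)"
  by (simp add: hermitian_adjoint_def tensor_op_def vec_eq_iff)

lemma unitary_tensor_op: "unitary A \<Longrightarrow> unitary B \<Longrightarrow> unitary (tensor_op A B)"
  by (simp add: unitary_def hermitian_adjoint_tensor_op tensor_op_mult tensor_op_mat_1)

lemma tensor_op_mult_tensor_vec:
  "tensor_op A B *v tensor_vec x y = tensor_vec (A *v x) (B *v y)"
  by (simp add: tensor_op_def tensor_vec_def matrix_vector_mult_def vec_eq_iff sum_UNIV_prod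
      sum_product mult.assoc mult.left_commute)

text \<open>With the identity on the first register, the slices with fixed first label evolve
  independently; the decoder is applied slice by slice in this way.\<close>

lemma tensor_op_mat_1_left_nth:
  "(tensor_op (mat 1) A *v s) $ (x, p) = (A *v (\<chi> q. s $ (x, q))) $ p"
  by (simp add: matrix_vector_mult_def tensor_op_def sum_UNIV_prod mat_def)
    (subst sum.swap, simp add: mult_delta_left)

text \<open>By injectivity only \<open>i\<close> contributes to the entry at \<open>f i\<close>. All
  relabellings of registers in the reduction are evaluated through this.\<close>

lemma basis_map_mult_nth:
  assumes "inj f"
  shows "(basis_map f *v s) $ f i = s $ i"
proof -
  have "(basis_map f *v s) $ f i = (\<Sum>j\<in>UNIV. if i = j then s $ j else 0)"
    using assms by (simp add: matrix_vector_mult_def basis_map_def inj_eq mult_delta_left)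

  then show ?thesis
    by simp
qed

text \<open>The inner product of \<open>A x\<close> with itself is that of \<open>x\<close> with
  \<open>A* A x = x\<close>. The index types of rows and columns may differ, as they do for the
  decoder.\<close>

lemma norm_unitary_mult:
  assumes "unitary A"
  shows "norm (A *v x) = norm x"
proof -
  have norm_eq: "complex_of_real ((norm y)\<^sup>2) = (\<Sum>i\<in>UNIV. cnj (y $ i) * y $ i)"
    for y :: "complex ^ 'k"
    by (simp add: norm_vec_square complex_norm_square mult.commute del: of_real_power)
  have "complex_of_real ((norm (A *v x))\<^sup>2)
      = (\<Sum>j\<in>UNIV. \<Sum>i\<in>UNIV. cnj (A $ j $ i) * cnj (x $ i) * (A *v x) $ j)"
    unfolding norm_eq
    by (simp add: matrix_vector_mult_def[of A] cnj_sum sum_distrib_right)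
  also have "\<dots> = (\<Sum>i\<in>UNIV. cnj (x $ i) * (hermitian_adjoint A *v (A *v x)) $ i)"
    unfolding matrix_vector_mult_def[of "hermitian_adjoint A"]
    by (subst sum.swap) (simp add: hermitian_adjoint_def sum_distrib_left mult_ac)
  also have "hermitian_adjoint A *v (A *v x) = x"
    using assms by (simp add: unitary_def matrix_vector_mul_assoc)
  also have "(\<Sum>i\<in>UNIV. cnj (x $ i) * x $ i) = complex_of_real ((norm x)\<^sup>2)"
    by (simp only: norm_eq)
  finally have "(norm (A *v x))\<^sup>2 = (norm x)\<^sup>2"
    by (simp only: of_real_eq_iff)
  then show ?thesis
    by simp
qed

section \<open>The operators Z^v and H, and Parseval's identity\<close>

lemma Z_op_mult_nth: "(Z_op v *v s) $ y = parity_sign v y * s $ y"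
  by (simp add: Z_op_def matrix_vector_mult_def mult_delta_left)

lemma unitary_Z_op: "unitary (Z_op v)"
proof -
  have "hermitian_adjoint (Z_op v) = Z_op v"
    unfolding hermitian_adjoint_def Z_op_def
    by (intro arg_cong[where f = vec_lambda] ext) auto
  moreover have "Z_op v ** Z_op v = mat 1"
    by (simp add: matrix_eq vec_eq_iff Z_op_mult_nth flip: matrix_vector_mul_assoc)
  ultimately show ?thesis
    by (simp add: unitary_def)
qed

text \<open>The entry at \<open>(y, x)\<close> is a normalized character sum at
  \<open>y + x\<close>, which vanishes unless \<open>y + x = 0\<close>, that is,
  \<open>y = x\<close>.\<close>

lemma hadamard_op_mult_self: "hadamard_op ** hadamard_op = (mat 1 :: complex ^ (bit ^ 'm) ^ (bit ^ 'm))"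
proof -
  let ?N = "2 ^ CARD('m) :: real"
  have "(\<Sum>z\<in>UNIV. complex_of_real (1 / sqrt ?N) * parity_sign z y
            * (complex_of_real (1 / sqrt ?N) * parity_sign x z)) = (if y = x then 1 else 0)"
    for x y :: "bit ^ 'm"
  proof -
    have "complex_of_real (1 / sqrt ?N) * parity_sign z y
          * (complex_of_real (1 / sqrt ?N) * parity_sign x z)
        = complex_of_real (1 / sqrt ?N * (1 / sqrt ?N)) * parity_sign z (y + x)" for z
      by (simp only: of_real_mult parity_sign_add_right parity_sign_commute[of x] mult_ac)
    moreover have "1 / sqrt ?N * (1 / sqrt ?N) = 1 / ?N"
      by simp
    ultimately have "(\<Sum>z\<in>UNIV. complex_of_real (1 / sqrt ?N) * parity_sign z y
            * (complex_of_real (1 / sqrt ?N) * parity_sign x z))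
        = complex_of_real (1 / ?N) * (\<Sum>z\<in>UNIV. parity_sign z (y + x))"
      by (simp only: sum_distrib_left)
    also have "\<dots> = (if y = x then 1 else 0)"
      unfolding sum_parity_sign_UNIV by (auto simp flip: bit_vec_diff)
    finally show ?thesis .
  qed
  then show ?thesis
    by (simp add: hadamard_op_def matrix_matrix_mult_def mat_def vec_eq_iff)
qed

lemma unitary_hadamard_op: "unitary (hadamard_op :: complex ^ (bit ^ 'm) ^ (bit ^ 'm))"
proof -
  have "hermitian_adjoint hadamard_op = (hadamard_op :: complex ^ (bit ^ 'm) ^ (bit ^ 'm))"
    by (auto simp: hermitian_adjoint_def hadamard_op_def vec_eq_iff parity_sign_commute)
  then show ?thesis
    by (simp only: unitary_def hadamard_op_mult_self)
qed

lemma hadamard_op_mult_vec_lambda: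
  "hadamard_op *v (\<chi> x. f x) = (\<chi> x. hadamard_transform f x)"
  by (simp add: vec_eq_iff hadamard_op_def hadamard_transform_def matrix_vector_mult_def
      sum_distrib_left mult.assoc)

lemma hadamard_transform_involution: "hadamard_transform (hadamard_transform f) = f"
proof -
  have "hadamard_op *v (hadamard_op *v (\<chi> x. f x)) = (\<chi> x. f x)"
    by (simp add: matrix_vector_mul_assoc hadamard_op_mult_self)
  then show ?thesis
    by (simp add: hadamard_op_mult_vec_lambda vec_eq_iff fun_eq_iff)
qed

lemma parseval_hadamard_transform:
  "(\<Sum>x\<in>UNIV. (cmod (hadamard_transform f x))\<^sup>2) = (\<Sum>x\<in>UNIV. (cmod (f x))\<^sup>2)"
proof -
  have "(norm (hadamard_op *v (\<chi> x. f x)))\<^sup>2 = (norm (\<chi> x. f x))\<^sup>2"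
    by (simp add: norm_unitary_mult unitary_hadamard_op)
  then show ?thesis
    by (simp add: hadamard_op_mult_vec_lambda norm_vec_square)
qed

text \<open>Unnormalized Parseval identity. Summing over \<open>v\<close> removes the cross terms
  between distinct \<open>d\<close>, which is what the randomness of \<open>v\<close> contributes to
  the error estimate.\<close>

lemma parseval_parity_sum:
  fixes z :: "bit ^ 'm::finite \<Rightarrow> complex"
  shows "(\<Sum>v\<in>UNIV. (cmod (\<Sum>d\<in>UNIV. parity_sign v d * z d))\<^sup>2)
    = 2 ^ CARD('m) * (\<Sum>d\<in>UNIV. (cmod (z d))\<^sup>2)"
proof -
  have "(cmod (\<Sum>d\<in>UNIV. parity_sign v d * z d))\<^sup>2
      = 2 ^ CARD('m) * (cmod (hadamard_transform z v))\<^sup>2" for v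
    by (simp add: hadamard_transform_def norm_mult norm_divide power_mult_distrib power_divide
        parity_sign_commute[of v])
  then show ?thesis
    by (simp add: sum_distrib_left[symmetric] parseval_hadamard_transform)
qed

section \<open>Duality of the code and its dual\<close>

lemma zero_in_dual_code: "0 \<in> dual_code B"
  by (simp add: dual_code_def)

text \<open>Moving \<open>B\<close> across the product turns \<open>d . (B x)\<close> into
  \<open>(B^T d) . x = 0\<close>.\<close>

lemma parity_sign_dual_code:
  assumes "d \<in> dual_code B" "c \<in> code B"
  shows "parity_sign d c = 1"
proof -
  obtain x where c: "c = B *v x"
    using assms(2) by (auto simp: code_def)
  show ?thesis
    using assms(1)
    by (simp add: parity_sign_def dual_code_def c scalar_product_transpose) (simp add: scalar_product_def)
qed

text \<open>A nonzero coordinate \<open>i\<close> of \<open>B^T d\<close> says that column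
  \<open>i\<close> of \<open>B\<close>, itself a codeword, is not orthogonal to
  \<open>d\<close>.\<close>

lemma ex_parity_sign_neq_1:
  assumes "d \<notin> dual_code B"
  shows "\<exists>c\<in>code B. parity_sign c d \<noteq> 1"
proof -
  obtain i where "(transpose B *v d) $ i = 1"
    using assms by (auto simp: dual_code_def vec_eq_iff bit_not_zero_iff)
  then have "scalar_product (B *v axis i 1) d = 1"
    by (simp add: scalar_product_def matrix_vector_mult_def transpose_def axis_def if_distrib
        cong: if_cong)
  then show ?thesis
    by (intro bexI[of _ "B *v axis i 1"]) (auto simp: parity_sign_def code_def)
qed

lemma code_add_closed: "x \<in> code B \<Longrightarrow> y \<in> code B \<Longrightarrow> x + y \<in> code B"
  by (auto simp: code_def simp flip: matrix_vector_right_distrib)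

(* Both sides count the sum of (-1)^(c.d) over all c in C and all vectors d. *)
lemma card_code_mult_card_dual_code:
  fixes B :: "bit ^ 'n ^ 'm"
  shows "card (code B) * card (dual_code B) = 2 ^ CARD('m)"
proof -
  have "(\<Sum>c\<in>code B. \<Sum>d\<in>UNIV. parity_sign d c) = (\<Sum>c\<in>code B. if c = 0 then 2 ^ CARD('m) else 0)"
    by (simp add: sum_parity_sign_UNIV)
  also have "\<dots> = 2 ^ CARD('m)"
    by (auto simp: code_def intro!: exI[of _ 0])
  finally have 1: "(\<Sum>c\<in>code B. \<Sum>d\<in>UNIV. parity_sign d c) = 2 ^ CARD('m)" .
  have "(\<Sum>c\<in>code B. parity_sign d c) = (if d \<in> dual_code B then of_nat (card (code B)) else 0)" for d
  proof (cases "d \<in> dual_code B")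
    case True
    then show ?thesis
      by (simp add: parity_sign_dual_code)
  next
    case False
    then show ?thesis
      using ex_parity_sign_neq_1[OF False] sum_parity_sign_eq_0[of "code B" _ d]
      by (auto simp: parity_sign_commute[of d] code_add_closed)
  qed
  then have "(\<Sum>c\<in>code B. \<Sum>d\<in>UNIV. parity_sign d c)
      = of_nat (card (code B) * card (dual_code B))"
    by (subst sum.swap) (simp add: sum.If_cases)
  with 1 have "of_nat (card (code B) * card (dual_code B)) = (of_nat (2 ^ CARD('m)) :: complex)"
    by simp
  then show ?thesis
    using of_nat_eq_iff by blast
qed

section \<open>Born rule and success probability of the decoder\<close>

lemma pmf_measure_last:
  fixes s :: "complex ^ ('i::finite \<times> 'j::finite)"
  assumes "norm s = 1"
  shows "pmf (measure_last s) x = (\<Sum>a\<in>UNIV. (cmod (s $ (a, x)))\<^sup>2)"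
  unfolding measure_last_def
proof (rule pmf_embed_pmf)
  have "(\<Sum>x\<in>UNIV. \<Sum>a\<in>UNIV. (cmod (s $ (a, x)))\<^sup>2) = (norm s)\<^sup>2"
    unfolding norm_vec_square sum_UNIV_prod by (rule sum.swap)
  then show "(\<integral>\<^sup>+ x. ennreal (\<Sum>a\<in>UNIV. (cmod (s $ (a, x)))\<^sup>2) \<partial>count_space UNIV) = 1"
    using assms by (simp add: nn_integral_count_space_finite sum_nonneg)
qed (simp add: sum_nonneg)

lemma pmf_measure_first:
  fixes s :: "complex ^ ('i::finite \<times> 'j::finite)"
  assumes "norm s = 1"
  shows "pmf (measure_first s) x = (\<Sum>a\<in>UNIV. (cmod (s $ (x, a)))\<^sup>2)"
  unfolding measure_first_def
proof (rule pmf_embed_pmf)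
  have "(\<Sum>x\<in>UNIV. \<Sum>a\<in>UNIV. (cmod (s $ (x, a)))\<^sup>2) = (norm s)\<^sup>2"
    unfolding norm_vec_square sum_UNIV_prod by (rule refl)
  then show "(\<integral>\<^sup>+ x. ennreal (\<Sum>a\<in>UNIV. (cmod (s $ (x, a)))\<^sup>2) \<partial>count_space UNIV) = 1"
    using assms by (simp add: nn_integral_count_space_finite sum_nonneg)
qed (simp add: sum_nonneg)

lemma error_state_nth: "error_state Q $ y = Q y"
  by (simp add: error_state_def ket_def axis_def mult_delta_right)

lemma noisy_state_nth: "noisy_state Q d $ y = Q (y + d)"
proof -
  have "y = d + e \<longleftrightarrow> e = y + d" for e
    by (metis add.commute bit_vec_add_self_left)
  then show ?thesis
    by (simp add: noisy_state_def ket_def axis_def mult_delta_right)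
qed

lemma norm_noisy_state:
  assumes "(\<Sum>x\<in>UNIV. (cmod (Q x))\<^sup>2) = 1"
  shows "norm (noisy_state Q d) = 1"
proof -
  have "(norm (noisy_state Q d))\<^sup>2 = 1"
    using assms sum_bit_vec_translate[of "\<lambda>x. (cmod (Q x))\<^sup>2" d]
    by (simp add: norm_vec_square noisy_state_nth)
  then show ?thesis
    using power2_eq_iff_nonneg[of "norm (noisy_state Q d)" 1] by simp
qed

text \<open>This is \<open>psi_d\<close> in the notation of the opening comment.\<close>

definition decoded_state ::
    "(bit ^ 'm \<Rightarrow> complex) \<Rightarrow> complex ^ ((bit ^ 'm) \<times> 'a::finite) ^ ('g::finite \<times> (bit ^ 'm))
      \<Rightarrow> complex ^ 'a \<Rightarrow> bit ^ 'm \<Rightarrow> complex ^ ('g \<times> (bit ^ 'm))" where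
  "decoded_state Q U anc d = U *v tensor_vec (noisy_state Q d) anc"

lemma norm_decoded_state:
  assumes "(\<Sum>x\<in>UNIV. (cmod (Q x))\<^sup>2) = 1" "unitary U" "norm anc = 1"
  shows "norm (decoded_state Q U anc d) = 1"
  using assms by (simp add: decoded_state_def norm_unitary_mult norm_tensor_vec norm_noisy_state)

text \<open>For fixed \<open>d\<close> the event singles out the outcome \<open>d\<close>, whose
  Born weight is the mass of the decoded state at last label \<open>d\<close>; the uniform
  \<open>d\<close> averages these masses.\<close>

lemma qdp_success_prob_eq:
  fixes D :: "(bit ^ 'm) set"
  assumes "(\<Sum>x\<in>UNIV. (cmod (Q x))\<^sup>2) = 1" "unitary U" "norm anc = 1" "D \<noteq> {}"
  shows "qdp_success_prob D Q U anc
    = (\<Sum>d\<in>D. \<Sum>g\<in>UNIV. (cmod (decoded_state Q U anc d $ (g, d)))\<^sup>2) / real (card D)"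
proof -
  let ?M = "\<lambda>d. do {d' \<leftarrow> measure_last (decoded_state Q U anc d); return_pmf (d, d')}"
  have "qdp_success_prob D Q U anc = measure_pmf.expectation (pmf_of_set D \<bind> ?M) (indicator {(d, d'). d' = d})"
    by (simp add: qdp_success_prob_def decoded_state_def)
  also have "\<dots> = (\<Sum>d\<in>D. measure_pmf.expectation (?M d) (indicator {(d, d'). d' = d}) /\<^sub>R real (card D))"
    using assms(4) by (intro pmf_expectation_bind_pmf_of_set) auto
  also have "\<dots> = (\<Sum>d\<in>D. pmf (measure_last (decoded_state Q U anc d)) d / real (card D))"
  proof (intro sum.cong refl)
    fix d
    have "?M d = map_pmf (Pair d) (measure_last (decoded_state Q U anc d))"
      by (simp add: map_pmf_def)
    moreover have "Pair d -` {(d, d'). d' = d} = {d}"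
      by auto
    ultimately show "measure_pmf.expectation (?M d) (indicator {(d, d'). d' = d}) /\<^sub>R real (card D)
        = pmf (measure_last (decoded_state Q U anc d)) d / real (card D)"
      by (simp add: measure_pmf_single field_simps)
  qed
  finally show ?thesis
    using assms by (simp add: pmf_measure_last norm_decoded_state sum_divide_distrib)
qed

(* Up to normalization, this is what postselection leaves of the state that Regev's reduction
   holds after decoding. *)
definition correctly_decoded_state ::
    "(bit ^ 'm) set \<Rightarrow> (bit ^ 'm \<Rightarrow> complex)
      \<Rightarrow> complex ^ ((bit ^ 'm) \<times> 'a::finite) ^ ('g::finite \<times> (bit ^ 'm))
      \<Rightarrow> complex ^ 'a \<Rightarrow> bit ^ 'm \<Rightarrow> complex ^ ('g \<times> (bit ^ 'm))" where
  "correctly_decoded_state D Q U anc v =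
    (\<chi> p. case p of (g, y) \<Rightarrow>
      if y \<in> D
      then complex_of_real (1 / sqrt (card D)) * parity_sign v y * decoded_state Q U anc y $ (g, y)
      else 0)"

text \<open>The signs have modulus 1, so the norm is the same for every \<open>v\<close>. Hence one
  normalization constant serves all runs of the reduction.\<close>

lemma norm_correctly_decoded_state:
  assumes "(\<Sum>x\<in>UNIV. (cmod (Q x))\<^sup>2) = 1" "unitary U" "norm anc = 1" "D \<noteq> {}"
  shows "(norm (correctly_decoded_state D Q U anc v))\<^sup>2 = qdp_success_prob D Q U anc"
proof -
  have "(norm (correctly_decoded_state D Q U anc v))\<^sup>2
      = (\<Sum>y\<in>UNIV. \<Sum>g\<in>UNIV.
          if y \<in> D then (cmod (decoded_state Q U anc y $ (g, y)))\<^sup>2 / real (card D) else 0)"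
    unfolding norm_vec_square sum_UNIV_prod
    by (subst sum.swap) (intro sum.cong refl,
        simp add: correctly_decoded_state_def norm_mult norm_divide power_mult_distrib power_divide)
  also have "\<dots> = (\<Sum>y\<in>UNIV. if y \<in> D
      then \<Sum>g\<in>UNIV. (cmod (decoded_state Q U anc y $ (g, y)))\<^sup>2 / real (card D) else 0)"
    by (intro sum.cong refl) simp
  finally show ?thesis
    using assms by (simp add: qdp_success_prob_eq sum.If_cases sum_divide_distrib)
qed

section \<open>Closed form of the state produced by the reduction\<close>

lemma inj_add_first_to_second: "inj (\<lambda>(x, y). (x, x + y :: bit ^ 'm))"
  by (auto simp: inj_def)

text \<open>Postselection correlates the first register perfectly with the decoded word, so
  subtraction resets it to 0 and leaves the normalized \<open>K_v\<close> in the remaining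
  registers.\<close>

lemma regev_state_eq:
  fixes B :: "bit ^ 'n ^ 'm"
    and U :: "complex ^ ((bit ^ 'm) \<times> 'a::finite) ^ ('g::finite \<times> (bit ^ 'm))"
  assumes "(\<Sum>x\<in>UNIV. (cmod (P x))\<^sup>2) = 1" "unitary U" "norm anc = 1"
  defines "D \<equiv> dual_code B" and "Q \<equiv> hadamard_transform P"
  shows "regev_state B P U anc v = complex_of_real (1 / sqrt (qdp_success_prob D Q U anc)) *s
    (tensor_op (Z_op v) (mat 1) *v (hermitian_adjoint U *v correctly_decoded_state D Q U anc v))"
proof -
  define c where "c = complex_of_real (1 / sqrt (card D))"
  define s0 where "s0 = tensor_vec (c *s (\<Sum>d\<in>D. ket d)) (error_state Q)"
  define s1 where "s1 = tensor_op (Z_op v) (mat 1) *v s0"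
  define s2 where "s2 = basis_map (\<lambda>(x, y). (x, x + y)) *v s1"
  define s3 where "s3 = basis_map (\<lambda>((x, y), a). (x, (y, a))) *v tensor_vec s2 anc"
  define s4 where "s4 = tensor_op (mat 1) U *v s3"
  define s5 where "s5 = postselect_equal s4"
  define s6 where "s6 = basis_map (\<lambda>(x, g, y). (x - y, g, y)) *v s5"
  define s7 where "s7 = (\<chi> q. s6 $ (0, q))"
  have regev: "regev_state B P U anc v = tensor_op (Z_op v) (mat 1) *v (hermitian_adjoint U *v s7)"
    by (simp add: regev_state_def Let_def s7_def s6_def s5_def s4_def s3_def s2_def s1_def s0_def
        c_def D_def Q_def)
  have Q: "(\<Sum>x\<in>UNIV. (cmod (Q x))\<^sup>2) = 1" "D \<noteq> {}"
    using assms(1) zero_in_dual_code[of B] by (auto simp: Q_def parseval_hadamard_transform D_def)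
  have s1: "s1 $ (x, y) = (if x \<in> D then c * parity_sign v x * Q y else 0)" for x y
    unfolding s1_def s0_def tensor_op_mult_tensor_vec
    by (simp add: tensor_vec_def Z_op_mult_nth error_state_nth ket_def axis_def mult_delta_right)
  \<comment> \<open>The argument is \<open>(x, x + y)\<close> because the map sends it to
    \<open>(x, y)\<close> in characteristic 2.\<close>
  have s2: "s2 $ (x, y) = s1 $ (x, x + y)" for x y
    using basis_map_mult_nth[OF inj_add_first_to_second, of s1 "(x, x + y)"] by (simp add: s2_def)
  have "inj (\<lambda>((x, y), a). (x :: bit ^ 'm, (y :: bit ^ 'm, a :: 'a)))"
    by (auto simp: inj_def)
  from basis_map_mult_nth[OF this, of "tensor_vec s2 anc" "((_, _), _)"]
  have s3: "s3 $ (x, (y, a)) = s2 $ (x, y) * anc $ a" for x y a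
    by (simp add: s3_def tensor_vec_def)
  \<comment> \<open>For a first label \<open>x\<close> in \<open>D\<close>, the error amplitude
    \<open>Q (x + y)\<close> at \<open>y\<close> is exactly the noisy state of the codeword
    \<open>x\<close>.\<close>
  have s3_slice: "(\<chi> q. s3 $ (x, q))
      = (if x \<in> D then c * parity_sign v x else 0) *s tensor_vec (noisy_state Q x) anc" for x
    by (auto simp: vec_eq_iff s3 s2 s1 tensor_vec_def noisy_state_nth add.commute)
  have s4: "s4 $ (x, q) = (if x \<in> D then c * parity_sign v x * decoded_state Q U anc x $ q else 0)"
    for x q
    by (simp add: s4_def tensor_op_mat_1_left_nth s3_slice vector_scalar_commute decoded_state_def)
  define t :: "complex ^ ((bit ^ 'm) \<times> ('g \<times> (bit ^ 'm)))" where
    "t = (\<chi> p. case p of (x, g, y) \<Rightarrow> if x = y then s4 $ (x, g, y) else 0)"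
  let ?K = "correctly_decoded_state D Q U anc v"
  have t: "t $ (x, g, y) = (if x = y then ?K $ (g, y) else 0)" for x g y
    by (simp add: t_def s4 correctly_decoded_state_def c_def)
  have "(norm t)\<^sup>2 = (\<Sum>x\<in>UNIV. \<Sum>g\<in>UNIV. \<Sum>y\<in>UNIV. if x = y then (cmod (?K $ (g, y)))\<^sup>2 else 0)"
    unfolding norm_vec_square sum_UNIV_prod t by (intro sum.cong refl) simp
  also have "\<dots> = (norm ?K)\<^sup>2"
    unfolding norm_vec_square sum_UNIV_prod by (subst sum.swap) simp
  finally have "norm t = sqrt (qdp_success_prob D Q U anc)"
    using Q assms(2,3) by (metis norm_correctly_decoded_state norm_ge_zero real_sqrt_unique)
  \<comment> \<open>This includes success probability 0: then \<open>sgn 0 = 0\<close> on one side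
    and division by 0 gives 0 on the other.\<close>
  then have s5: "s5 $ p = complex_of_real (1 / sqrt (qdp_success_prob D Q U anc)) * t $ p" for p
    by (simp add: s5_def postselect_equal_def sgn_div_norm t_def[symmetric] divide_inverse)
      (simp add: scaleR_conv_of_real)
  have "inj (\<lambda>(x, g, y). (x - y :: bit ^ 'm, g :: 'g, y))"
    by (auto simp: inj_def)
  from basis_map_mult_nth[OF this, of s5 "(_, _, _)"]
  have s6: "s6 $ (x - y, g, y) = s5 $ (x, g, y)" for x y g
    by (simp add: s6_def)
  \<comment> \<open>Label \<open>0\<close> of the first register receives exactly the diagonal
    labels \<open>(x, g, x)\<close>, on which the postselected state is supported.\<close>
  have "s7 = complex_of_real (1 / sqrt (qdp_success_prob D Q U anc)) *s ?K"
    using s6[of x x for x] by (auto simp: s7_def vec_eq_iff s5 t)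
  then show ?thesis
    unfolding regev by (simp add: vector_scalar_commute)
qed

section \<open>The ideal superposition and its distance from the postselected one\<close>

lemma matrix_vector_mult_sum_right: "A *v (\<Sum>i\<in>I. f i) = (\<Sum>i\<in>I. A *v f i)"
  by (induction I rule: infinite_finite_induct) (simp_all add: matrix_vector_right_distrib)

text \<open>This is \<open>S_v\<close>, with wrong decoder outcomes retained. It need not be a unit
  vector, since noisy states of different \<open>d\<close> can overlap.\<close>

definition superposed_decoded_state ::
    "(bit ^ 'm) set \<Rightarrow> (bit ^ 'm \<Rightarrow> complex)
      \<Rightarrow> complex ^ ((bit ^ 'm) \<times> 'a::finite) ^ ('g::finite \<times> (bit ^ 'm))
      \<Rightarrow> complex ^ 'a \<Rightarrow> bit ^ 'm \<Rightarrow> complex ^ ('g \<times> (bit ^ 'm))" where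
  "superposed_decoded_state D Q U anc v =
    (\<Sum>d\<in>D. (complex_of_real (1 / sqrt (card D)) * parity_sign v d) *s decoded_state Q U anc d)"

text \<open>The Hadamard transform exchanges shifts and phases: the shift by \<open>d\<close>
  becomes a sign, the phase of Z^v becomes a shift by \<open>v\<close>, and transforming twice
  restores \<open>P\<close>.\<close>

lemma hadamard_Z_noisy_state_nth:
  "(hadamard_op *v (Z_op v *v noisy_state (hadamard_transform P) d)) $ y
    = parity_sign d y * parity_sign v d * P (y + v)"
proof -
  let ?Q = "hadamard_transform P"
  have "Z_op v *v noisy_state ?Q d = (\<chi> x. parity_sign v x * ?Q (x + d))"
    by (simp add: vec_eq_iff Z_op_mult_nth noisy_state_nth)
  then have "(hadamard_op *v (Z_op v *v noisy_state ?Q d)) $ y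
      = hadamard_transform (\<lambda>x. parity_sign v x * ?Q (x + d)) y"
    by (simp add: hadamard_op_mult_vec_lambda)
  also have "\<dots> = complex_of_real (1 / sqrt (2 ^ CARD('a)))
      * (\<Sum>x\<in>UNIV. parity_sign (x + d) y * (parity_sign v (x + d) * ?Q x))"
    unfolding hadamard_transform_def[of "\<lambda>x. parity_sign v x * ?Q (x + d)"]
    using sum_bit_vec_translate[of "\<lambda>x. parity_sign x y * (parity_sign v x * ?Q (x + d))" d]
    by simp
  \<comment> \<open>All signs involving \<open>d\<close> leave the sum; the two characters in
    \<open>x\<close> combine into one at \<open>y + v\<close>.\<close>
  also have "(\<Sum>x\<in>UNIV. parity_sign (x + d) y * (parity_sign v (x + d) * ?Q x))
      = parity_sign d y * parity_sign v d * (\<Sum>x\<in>UNIV. parity_sign x (y + v) * ?Q x)"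
    by (simp only: sum_distrib_left parity_sign_add_left parity_sign_add_right
        parity_sign_commute[of v] mult_ac)
  finally have "(hadamard_op *v (Z_op v *v noisy_state ?Q d)) $ y
      = parity_sign d y * parity_sign v d * hadamard_transform ?Q (y + v)"
    by (simp only: hadamard_transform_def[of ?Q] mult_ac)
  then show ?thesis
    by (simp only: hadamard_transform_involution)
qed

text \<open>The two signs from \<open>v\<close> and \<open>d\<close> cancel, and the sign from
  \<open>d\<close> and \<open>y\<close> is 1 on the code. Thus \<open>card D\<close> equal terms of
  weight \<open>1 / sqrt (card D)\<close> add up coherently to \<open>sqrt (card D)\<close>.\<close>

lemma superposed_decoded_state_on_code:
  fixes B :: "bit ^ 'n ^ 'm"
  assumes "unitary U" "y \<in> code B"
  defines "D \<equiv> dual_code B"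
  shows "(tensor_op hadamard_op (mat 1) *v (tensor_op (Z_op v) (mat 1) *v
      (hermitian_adjoint U *v superposed_decoded_state D (hadamard_transform P) U anc v))) $ (y, a)
    = complex_of_real (sqrt (card D)) * P (y + v) * anc $ a"
proof -
  let ?Q = "hadamard_transform P"
  let ?c = "complex_of_real (1 / sqrt (card D))"
  have "hermitian_adjoint U *v decoded_state ?Q U anc d = tensor_vec (noisy_state ?Q d) anc" for d
    using assms(1) by (simp add: decoded_state_def matrix_vector_mul_assoc unitary_def)
  then have "tensor_op hadamard_op (mat 1) *v (tensor_op (Z_op v) (mat 1) *v
      (hermitian_adjoint U *v superposed_decoded_state D ?Q U anc v))
    = (\<Sum>d\<in>D. (?c * parity_sign v d)
        *s tensor_vec (hadamard_op *v (Z_op v *v noisy_state ?Q d)) anc)"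
    by (simp add: superposed_decoded_state_def matrix_vector_mult_sum_right vector_scalar_commute
        tensor_op_mult_tensor_vec)
  then have "(tensor_op hadamard_op (mat 1) *v (tensor_op (Z_op v) (mat 1) *v
      (hermitian_adjoint U *v superposed_decoded_state D ?Q U anc v))) $ (y, a)
    = (\<Sum>d\<in>D. ?c * parity_sign v d * (parity_sign d y * parity_sign v d * P (y + v) * anc $ a))"
    by (simp add: tensor_vec_def hadamard_Z_noisy_state_nth)
  also have "\<dots> = (\<Sum>d\<in>D. ?c * (P (y + v) * anc $ a))"
    using assms(2) by (intro sum.cong refl) (simp add: D_def parity_sign_dual_code mult_ac)
  also have "\<dots> = (complex_of_nat (card D) * ?c) * (P (y + v) * anc $ a)"
    by simp
  also have "complex_of_nat (card D) * ?c = complex_of_real (real (card D) / sqrt (card D))"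
    by simp
  finally show ?thesis
    by (simp add: real_div_sqrt)
qed

text \<open>Parseval over \<open>v\<close> reduces the squared distance to the masses that the
  individual decoded states put on wrong outcomes, without interference between different
  \<open>d\<close>.\<close>

lemma sum_norm_decoding_error:
  fixes D :: "(bit ^ 'm) set"
  assumes "(\<Sum>x\<in>UNIV. (cmod (Q x))\<^sup>2) = 1" "unitary U" "norm anc = 1" "D \<noteq> {}"
  shows "(\<Sum>v\<in>UNIV. (norm (superposed_decoded_state D Q U anc v
      - correctly_decoded_state D Q U anc v))\<^sup>2) = 2 ^ CARD('m) * (1 - qdp_success_prob D Q U anc)"
proof -
  let ?\<psi> = "decoded_state Q U anc"
  let ?c = "complex_of_real (1 / sqrt (card D))"
  \<comment> \<open>Subtracting \<open>K_v\<close> deletes exactly the term \<open>d = y\<close>,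
    the correct outcome.\<close>
  let ?z = "\<lambda>g y d. if d \<in> D \<and> d \<noteq> y then ?c * ?\<psi> d $ (g, y) else 0"
  have diff: "(superposed_decoded_state D Q U anc v - correctly_decoded_state D Q U anc v) $ (g, y)
      = (\<Sum>d\<in>UNIV. parity_sign v d * ?z g y d)" for v g y
  proof -
    have "(\<Sum>d\<in>UNIV. parity_sign v d * ?z g y d)
        = (\<Sum>d\<in>UNIV. if d \<in> D then ?c * parity_sign v d * ?\<psi> d $ (g, y) else 0)
          - (\<Sum>d\<in>UNIV. if d = y then if y \<in> D then ?c * parity_sign v y * ?\<psi> y $ (g, y) else 0 else 0)"
      unfolding sum_subtractf[symmetric] by (intro sum.cong refl) auto
    then show ?thesis
      by (simp add: superposed_decoded_state_def correctly_decoded_state_def sum.If_cases)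
  qed
  \<comment> \<open>In this form, summing over \<open>g\<close> and \<open>y\<close> yields the full
    squared norm of \<open>?\<psi> d\<close> minus its weight on the correct outcome.\<close>
  have cmod_z: "(cmod (?z g y d))\<^sup>2 = (if d \<in> D then ((cmod (?\<psi> d $ (g, y)))\<^sup>2
      - (if y = d then (cmod (?\<psi> d $ (g, d)))\<^sup>2 else 0)) / real (card D) else 0)" for g y d
    by (simp add: norm_mult norm_divide power_mult_distrib power_divide)
  have "(\<Sum>v\<in>UNIV. (norm (superposed_decoded_state D Q U anc v
      - correctly_decoded_state D Q U anc v))\<^sup>2)
      = (\<Sum>v\<in>UNIV. \<Sum>g\<in>UNIV. \<Sum>y\<in>UNIV. (cmod (\<Sum>d\<in>UNIV. parity_sign v d * ?z g y d))\<^sup>2)"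
    unfolding norm_vec_square sum_UNIV_prod diff by (rule refl)
  also have "\<dots> = (\<Sum>g\<in>UNIV. \<Sum>y\<in>UNIV. \<Sum>v\<in>UNIV. (cmod (\<Sum>d\<in>UNIV. parity_sign v d * ?z g y d))\<^sup>2)"
    by (subst sum.swap, rule sum.cong[OF refl], rule sum.swap)
  also have "\<dots> = 2 ^ CARD('m) * (\<Sum>g\<in>UNIV. \<Sum>y\<in>UNIV. \<Sum>d\<in>UNIV. (cmod (?z g y d))\<^sup>2)"
    unfolding parseval_parity_sum sum_distrib_left[symmetric] by (rule refl)
  also have "(\<Sum>g\<in>UNIV. \<Sum>y\<in>UNIV. \<Sum>d\<in>UNIV. (cmod (?z g y d))\<^sup>2)
      = (\<Sum>g\<in>UNIV. \<Sum>d\<in>UNIV. \<Sum>y\<in>UNIV. (cmod (?z g y d))\<^sup>2)"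
    by (rule sum.cong[OF refl], rule sum.swap)
  also have "\<dots> = (\<Sum>d\<in>UNIV. \<Sum>g\<in>UNIV. \<Sum>y\<in>UNIV. (cmod (?z g y d))\<^sup>2)"
    by (rule sum.swap)
  also have "\<dots> = (\<Sum>d\<in>UNIV. if d \<in> D then ((norm (?\<psi> d))\<^sup>2
      - (\<Sum>g\<in>UNIV. (cmod (?\<psi> d $ (g, d)))\<^sup>2)) / real (card D) else 0)"
    unfolding cmod_z norm_vec_square sum_UNIV_prod
    by (intro sum.cong refl) (simp add: sum_divide_distrib[symmetric] sum_subtractf)
  also have "\<dots> = 1 - qdp_success_prob D Q U anc"
    using assms
    by (simp add: sum.If_cases norm_decoded_state qdp_success_prob_eq sum_subtractf
        flip: sum_divide_distrib) (simp add: diff_divide_distrib)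
  finally show ?thesis .
qed

section \<open>Two general estimates: perturbing an L2 norm and conditioning a distribution\<close>

text \<open>With \<open>X\<close> and \<open>Y\<close> the weighted L2 norms of \<open>f\<close> and
  \<open>g\<close>, the triangle inequality gives \<open>X \<le> Y + sqrt e\<close>; factoring
  \<open>X^2 - Y^2\<close> then uses \<open>X \<le> 1\<close>.\<close>

lemma weighted_square_sum_perturbation:
  fixes f g :: "'i \<Rightarrow> 'b::real_normed_vector"
  assumes w: "\<And>i. i \<in> S \<Longrightarrow> 0 \<le> w i" "\<And>i. i \<in> S \<Longrightarrow> w i \<le> (1::real)"
    and f: "(\<Sum>i\<in>S. w i * (norm (f i))\<^sup>2) \<le> 1"
    and e: "(\<Sum>i\<in>S. (norm (f i - g i))\<^sup>2) \<le> e"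
  shows "(\<Sum>i\<in>S. w i * (norm (f i))\<^sup>2) - 2 * sqrt e \<le> (\<Sum>i\<in>S. w i * (norm (g i))\<^sup>2)"
proof -
  define X where "X = L2_set (\<lambda>i. sqrt (w i) * norm (f i)) S"
  define Y where "Y = L2_set (\<lambda>i. sqrt (w i) * norm (g i)) S"
  have X2: "X\<^sup>2 = (\<Sum>i\<in>S. w i * (norm (f i))\<^sup>2)" and Y2: "Y\<^sup>2 = (\<Sum>i\<in>S. w i * (norm (g i))\<^sup>2)"
    using w(1) by (simp_all add: X_def Y_def L2_set_def sum_nonneg power_mult_distrib)
  have nonneg: "0 \<le> X" "0 \<le> Y"
    by (simp_all add: X_def Y_def)
  have "X \<le> L2_set (\<lambda>i. sqrt (w i) * norm (g i) + norm (f i - g i)) S"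
    unfolding X_def
  proof (rule L2_set_mono)
    fix i assume "i \<in> S"
    have "sqrt (w i) * norm (f i) \<le> sqrt (w i) * (norm (g i) + norm (f i - g i))"
      using w(1)[OF \<open>i \<in> S\<close>] norm_triangle_sub[of "f i" "g i"] by (intro mult_left_mono) auto
    \<comment> \<open>The weight on the difference is dropped, being at most 1.\<close>
    also have "\<dots> \<le> sqrt (w i) * norm (g i) + norm (f i - g i)"
      using w[OF \<open>i \<in> S\<close>] by (simp add: distrib_left mult_left_le_one_le)
    finally show "sqrt (w i) * norm (f i) \<le> sqrt (w i) * norm (g i) + norm (f i - g i)" .
  qed (use w(1) in auto)
  also have "\<dots> \<le> Y + L2_set (\<lambda>i. norm (f i - g i)) S"
    unfolding Y_def by (rule L2_set_triangle_ineq)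
  also have "L2_set (\<lambda>i. norm (f i - g i)) S \<le> sqrt e"
    using e by (simp add: L2_set_def)
  finally have XY: "X \<le> Y + sqrt e"
    by simp
  have "X \<le> 1"
    using f power2_le_imp_le[of X 1] by (simp add: X2[symmetric])
  have "0 \<le> e"
    using e by (meson order_trans sum_nonneg zero_le_power2)
  have "X\<^sup>2 - Y\<^sup>2 \<le> 2 * sqrt e"
  \<comment> \<open>If \<open>X \<le> Y\<close> the left side is not positive. Otherwise
    \<open>Y < X \<le> 1\<close> bounds \<open>X + Y\<close> by 2, the source of the
    constant.\<close>
  proof (cases "X \<le> Y")
    case True
    then have "X\<^sup>2 \<le> Y\<^sup>2"
      using nonneg by (simp add: power_mono)
    then show ?thesis
      using \<open>0 \<le> e\<close> real_sqrt_ge_zero[of e] by linarith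
  next
    case False
    have "X\<^sup>2 - Y\<^sup>2 = (X + Y) * (X - Y)"
      by (simp add: power2_eq_square algebra_simps)
    also have "\<dots> \<le> 2 * sqrt e"
      using False XY \<open>X \<le> 1\<close> nonneg by (intro mult_mono) auto
    finally show ?thesis .
  qed
  then show ?thesis
    by (simp add: X2 Y2)
qed

text \<open>Conditioning divides the weights on \<open>C\<close> by a number at most 1. If that
  number is 0, the left side vanishes and nonnegativity of \<open>u\<close> covers any fallback
  \<open>z\<close>.\<close>

lemma expectation_cond_pmf_ge:
  fixes p :: "'b::finite pmf"
  assumes "\<And>x. (0::real) \<le> u x"
  shows "(\<Sum>x\<in>C. pmf p x * u x) \<le> measure_pmf.expectation
    (if measure_pmf.prob p C = 0 then return_pmf z else cond_pmf p C) u"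
proof (cases "measure_pmf.prob p C = 0")
  case True
  then have "pmf p x = 0" if "x \<in> C" for x
    using that unfolding measure_pmf_zero_iff by (metis IntI empty_iff pmf_eq_0_set_pmf)
  then show ?thesis
    using True assms by simp
next
  case False
  then have C: "set_pmf p \<inter> C \<noteq> {}"
    by (simp add: measure_pmf_zero_iff)
  have "(\<Sum>x\<in>C. pmf p x * u x) \<le> (\<Sum>x\<in>C. pmf (cond_pmf p C) x * u x)"
  proof (rule sum_mono)
    fix x assume "x \<in> C"
    have "pmf p x \<le> pmf p x / measure_pmf.prob p C"
      using False measure_pmf.prob_le_1[of p C] by (simp add: zero_less_measure_iff pos_le_divide_eq mult_left_le)
    from mult_right_mono[OF this assms] show "pmf p x * u x \<le> pmf (cond_pmf p C) x * u x"
      using \<open>x \<in> C\<close> by (simp add: pmf_cond[OF C])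
  qed
  also have "\<dots> \<le> (\<Sum>x\<in>UNIV. pmf (cond_pmf p C) x * u x)"
    using assms by (intro sum_mono2) auto
  also have "\<dots> = measure_pmf.expectation (cond_pmf p C) u"
    by (subst integral_measure_pmf[of UNIV]) auto
  finally show ?thesis
    using False by simp
qed

section \<open>The expected fraction of satisfied constraints\<close>

text \<open>Evaluated at \<open>c - v\<close>, this is the fraction of coordinates on which
  \<open>c\<close> and \<open>v\<close> agree, the max-XORSAT objective.\<close>

definition relative_agreement :: "bit ^ 'm \<Rightarrow> real" where
  "relative_agreement x = 1 - real (hamming_weight x) / real CARD('m)"

lemma relative_agreement_bounds: "0 \<le> relative_agreement x" "relative_agreement x \<le> 1"
proof -
  have "hamming_weight x \<le> CARD('a)"
    by (simp add: hamming_weight_def card_mono)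
  then show "0 \<le> relative_agreement x" "relative_agreement x \<le> 1"
    by (simp_all add: relative_agreement_def)
qed

text \<open>The probabilities are the Born weights of the unnormalized \<open>K_v\<close> after the
  final operators, over the common factor. Positivity makes the actual state a unit vector, so that
  the Born weights do form a distribution.\<close>

lemma pmf_regev_outcome:
  fixes B :: "bit ^ 'n ^ 'm"
    and U :: "complex ^ ((bit ^ 'm) \<times> 'a::finite) ^ ('g::finite \<times> (bit ^ 'm))"
  assumes "(\<Sum>x\<in>UNIV. (cmod (P x))\<^sup>2) = 1" "unitary U" "norm anc = 1"
  defines "D \<equiv> dual_code B" and "Q \<equiv> hadamard_transform P"
  assumes pos: "0 < qdp_success_prob D Q U anc"
  shows "pmf (regev_outcome B P U anc v) c
    = (\<Sum>a\<in>UNIV. (cmod ((tensor_op hadamard_op (mat 1) *v (tensor_op (Z_op v) (mat 1) *v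
        (hermitian_adjoint U *v correctly_decoded_state D Q U anc v))) $ (c, a)))\<^sup>2)
      / qdp_success_prob D Q U anc"
proof -
  let ?p = "qdp_success_prob D Q U anc"
  let ?s = "tensor_op hadamard_op (mat 1) *v (tensor_op (Z_op v) (mat 1) *v
      (hermitian_adjoint U *v correctly_decoded_state D Q U anc v))"
  have state: "tensor_op hadamard_op (mat 1) *v regev_state B P U anc v
      = complex_of_real (1 / sqrt ?p) *s ?s"
    unfolding regev_state_eq[OF assms(1-3), of B v, folded D_def Q_def] vector_scalar_commute
    by (rule refl)
  have Q: "(\<Sum>x\<in>UNIV. (cmod (Q x))\<^sup>2) = 1" "D \<noteq> {}"
    using assms(1) zero_in_dual_code[of B] by (auto simp: Q_def parseval_hadamard_transform D_def)
  have "(norm ?s)\<^sup>2 = ?p"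
    using assms(2,3) Q norm_correctly_decoded_state[of Q U anc D v]
    by (simp add: norm_unitary_mult unitary_tensor_op unitary_hadamard_op unitary_Z_op
        unitary_mat_1 unitary_hermitian_adjoint)
  then have "norm ?s = sqrt ?p"
    by (metis norm_ge_zero real_sqrt_unique)
  then have "norm (complex_of_real (1 / sqrt ?p) *s ?s) = 1"
    unfolding norm_vec_scale using pos by (simp add: norm_divide)
  then show ?thesis
    using pos unfolding regev_outcome_def state
    by (simp add: pmf_measure_first norm_mult norm_divide power_mult_distrib power_divide
        sum_divide_distrib)
qed

theorem corollary1:
  fixes B :: "bit ^ 'n ^ 'm"
    and P :: "bit ^ 'm \<Rightarrow> complex"
    and U :: "complex ^ ((bit ^ 'm) \<times> 'a::finite) ^ ('g::finite \<times> (bit ^ 'm))"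
    and anc :: "complex ^ 'a"
    and fallback :: "bit ^ 'm \<Rightarrow> bit ^ 'm"
    and \<epsilon> :: real
  assumes "(\<Sum>x\<in>UNIV. (cmod (P x))\<^sup>2) = 1"
    and "unitary U"
    and "norm anc = 1"
    and "qdp_success_prob (dual_code B) (hadamard_transform P) U anc = 1 - \<epsilon>"
    and "\<epsilon> < 1"
    and "\<And>v. fallback v \<in> code B"
  shows "(\<forall>v. set_pmf (regev_output fallback B P U anc v) \<subseteq> code B) \<and>
    measure_pmf.expectation
      (do { v \<leftarrow> pmf_of_set UNIV;
            c \<leftarrow> regev_output fallback B P U anc v;
            return_pmf (v, c) })
      (\<lambda>(v, c). 1 - real (hamming_weight (c - v)) / real CARD('m))
    \<ge> (\<Sum>y\<in>UNIV. (cmod (P y))\<^sup>2 * (1 - real (hamming_weight y) / real CARD('m))) - 2 * sqrt \<epsilon>"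
proof
  show "\<forall>v. set_pmf (regev_output fallback B P U anc v) \<subseteq> code B"
  proof
    fix v
    show "set_pmf (regev_output fallback B P U anc v) \<subseteq> code B"
    proof (cases "measure_pmf.prob (regev_outcome B P U anc v) (code B) = 0")
      case True
      then show ?thesis
        using assms(6) by (simp add: regev_output_def)
    next
      case False
      then have "set_pmf (regev_outcome B P U anc v) \<inter> code B \<noteq> {}"
        unfolding measure_pmf_zero_iff .
      then show ?thesis
        using False by (simp add: regev_output_def)
    qed
  qed
  define D where "D = dual_code B"
  define Q where "Q = hadamard_transform P"
  define N :: real where "N = 2 ^ CARD('m)"
  define V where "V v s = tensor_op hadamard_op (mat 1) *v (tensor_op (Z_op v) (mat 1) *v
      (hermitian_adjoint U *v s))" for v s
  \<comment> \<open>The factor \<open>1 / sqrt N\<close> absorbs the average over \<open>v\<close>,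
    so \<open>f\<close> and \<open>g\<close> can be compared in a single L2 space over triples
    \<open>(v, c, a)\<close>.\<close>
  define f where "f = (\<lambda>(v, q). V v (superposed_decoded_state D Q U anc v) $ q / sqrt N)"
  define g where "g = (\<lambda>(v, q). V v (correctly_decoded_state D Q U anc v) $ q / sqrt N)"
  \<comment> \<open>Weight 0 off the code makes the sums count only outcomes that the procedure can
    keep.\<close>
  define w :: "(bit ^ 'm) \<times> (bit ^ 'm) \<times> 'a \<Rightarrow> real" where
    "w = (\<lambda>(v, c, a). if c \<in> code B then relative_agreement (c - v) else 0)"
  let ?out = "regev_output fallback B P U anc"
  have N: "N > 0"
    by (simp add: N_def)
  have Q: "(\<Sum>x\<in>UNIV. (cmod (Q x))\<^sup>2) = 1" "D \<noteq> {}"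
    using assms(1) zero_in_dual_code[of B] by (auto simp: Q_def parseval_hadamard_transform D_def)
  have success: "qdp_success_prob D Q U anc = 1 - \<epsilon>"
    using assms(4) by (simp add: D_def Q_def)
  have "qdp_success_prob D Q U anc \<le> 1"
    by (simp add: qdp_success_prob_def)
  then have "0 \<le> \<epsilon>"
    by (simp add: success)
  have norm_V: "norm (V v s) = norm s" for v s
    using assms(2)
    by (simp add: V_def norm_unitary_mult unitary_tensor_op unitary_hadamard_op unitary_Z_op
        unitary_mat_1 unitary_hermitian_adjoint)
  have V_diff: "V v s - V v t = V v (s - t)" for v s t
    by (simp add: V_def matrix_vector_mult_diff_distrib)

  \<comment> \<open>The ancilla factors out and contributes \<open>(norm anc)^2 = 1\<close>.\<close>
  have "(\<Sum>a\<in>UNIV. w (v, c, a) * (cmod (f (v, c, a)))\<^sup>2) = (if c \<in> code B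
      then real (card D) / N * ((cmod (P (v + c)))\<^sup>2 * relative_agreement (v + c)) else 0)" for v c
  proof (cases "c \<in> code B")
    case True
    have "V v (superposed_decoded_state D Q U anc v) $ (c, a)
        = complex_of_real (sqrt (card D)) * P (v + c) * anc $ a" for a
      using superposed_decoded_state_on_code[OF assms(2) True, of v P anc a]
      by (simp add: V_def D_def Q_def add.commute)
    then have "(cmod (f (v, c, a)))\<^sup>2
        = real (card D) / N * (cmod (P (v + c)))\<^sup>2 * (cmod (anc $ a))\<^sup>2" for a
      using N by (simp add: f_def norm_mult norm_divide power_mult_distrib power_divide)
    then have "(\<Sum>a\<in>UNIV. w (v, c, a) * (cmod (f (v, c, a)))\<^sup>2)
        = real (card D) / N * (cmod (P (v + c)))\<^sup>2 * relative_agreement (v + c) * (norm anc)\<^sup>2"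
      using True
      by (simp add: w_def norm_vec_square sum_distrib_left sum_divide_distrib bit_vec_diff
          add.commute mult_ac)
    then show ?thesis
      using True assms(3) by simp
  qed (simp add: w_def)
  \<comment> \<open>The sum over \<open>v\<close> goes inside: for fixed \<open>c\<close>, the
    vector \<open>v + c\<close> runs over the whole space, so every codeword contributes the same
    amount.\<close>
  then have "(\<Sum>p\<in>UNIV. w p * (cmod (f p))\<^sup>2) = (\<Sum>c\<in>UNIV. \<Sum>v\<in>UNIV. if c \<in> code B
      then real (card D) / N * ((cmod (P (v + c)))\<^sup>2 * relative_agreement (v + c)) else 0)"
    unfolding sum_UNIV_prod by (subst sum.swap) simp
  also have "\<dots> = (\<Sum>c\<in>UNIV. if c \<in> code B
      then real (card D) / N * (\<Sum>v\<in>UNIV. (cmod (P (v + c)))\<^sup>2 * relative_agreement (v + c)) else 0)"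
    by (intro sum.cong refl) (simp add: sum_distrib_left)
  also have "\<dots> = real (card (code B) * card D) / N
      * (\<Sum>y\<in>UNIV. (cmod (P y))\<^sup>2 * relative_agreement y)"
    by (subst sum_bit_vec_translate[where f = "\<lambda>y. (cmod (P y))\<^sup>2 * relative_agreement y"])
      (simp add: sum.If_cases)
  also have "real (card (code B) * card D) / N = 1"
    unfolding D_def card_code_mult_card_dual_code by (simp add: N_def)
  finally have F: "(\<Sum>p\<in>UNIV. w p * (cmod (f p))\<^sup>2)
      = (\<Sum>y\<in>UNIV. (cmod (P y))\<^sup>2 * relative_agreement y)"
    by simp

  have G: "(\<Sum>p\<in>UNIV. w p * (cmod (g p))\<^sup>2)
      \<le> (\<Sum>v\<in>UNIV. measure_pmf.expectation (?out v) (\<lambda>c. relative_agreement (c - v)) / N)"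
    unfolding sum_UNIV_prod[of "\<lambda>p. w p * (cmod (g p))\<^sup>2"]
  proof (rule sum_mono)
    fix v
    have "(\<Sum>q\<in>UNIV. w (v, q) * (cmod (g (v, q)))\<^sup>2)
        \<le> (\<Sum>c\<in>UNIV. if c \<in> code B
            then pmf (regev_outcome B P U anc v) c * relative_agreement (c - v) / N else 0)"
      unfolding sum_UNIV_prod
    proof (rule sum_mono)
      fix c
      let ?A = "\<Sum>a\<in>UNIV. (cmod (V v (correctly_decoded_state D Q U anc v) $ (c, a)))\<^sup>2"
      \<comment> \<open>Since \<open>0 < 1 - \<epsilon> \<le> 1\<close>, normalizing the state does
        not lower its Born weights.\<close>
      have "?A \<le> ?A / (1 - \<epsilon>)"
        using \<open>0 \<le> \<epsilon>\<close> assms(5) by (simp add: pos_le_divide_eq mult_left_le sum_nonneg)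
      also have "?A / (1 - \<epsilon>) = pmf (regev_outcome B P U anc v) c"
        using pmf_regev_outcome[OF assms(1-3), of B v c] assms(5)
        by (simp add: success[unfolded D_def Q_def] V_def D_def Q_def)
      finally have "?A * relative_agreement (c - v) / N
          \<le> pmf (regev_outcome B P U anc v) c * relative_agreement (c - v) / N"
        using N relative_agreement_bounds by (intro divide_right_mono mult_right_mono) auto
      moreover have "(\<Sum>a\<in>UNIV. w (v, c, a) * (cmod (g (v, c, a)))\<^sup>2)
          = (if c \<in> code B then ?A * relative_agreement (c - v) / N else 0)"
        using N
        by (simp add: w_def g_def norm_divide power_divide sum_distrib_left sum_divide_distrib
            mult_ac)
      ultimately show "(\<Sum>a\<in>UNIV. w (v, c, a) * (cmod (g (v, c, a)))\<^sup>2) \<le> (if c \<in> code B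
          then pmf (regev_outcome B P U anc v) c * relative_agreement (c - v) / N else 0)"
        by simp
    qed
    also have "\<dots> = (\<Sum>c\<in>code B. pmf (regev_outcome B P U anc v) c * relative_agreement (c - v)) / N"
      by (simp add: sum.If_cases sum_divide_distrib)
    also have "\<dots> \<le> measure_pmf.expectation (?out v) (\<lambda>c. relative_agreement (c - v)) / N"
      unfolding regev_output_def using N relative_agreement_bounds
      by (intro divide_right_mono expectation_cond_pmf_ge) auto
    finally show "(\<Sum>q\<in>UNIV. w (v, q) * (cmod (g (v, q)))\<^sup>2)
        \<le> measure_pmf.expectation (?out v) (\<lambda>c. relative_agreement (c - v)) / N" .
  qed

  \<comment> \<open>\<open>V v\<close> is linear and preserves norms, so the error can be measured
    before the decoder is undone.\<close>
  have "(\<Sum>p\<in>UNIV. (cmod (f p - g p))\<^sup>2) = (\<Sum>v\<in>UNIV. (norm (V v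
      (superposed_decoded_state D Q U anc v - correctly_decoded_state D Q U anc v)))\<^sup>2) / N"
    unfolding sum_UNIV_prod[of "\<lambda>p. (cmod (f p - g p))\<^sup>2"] V_diff[symmetric] norm_vec_square
    using N
    by (simp add: f_def g_def norm_divide power_divide sum_divide_distrib flip: diff_divide_distrib)
  also have "\<dots> = \<epsilon>"
    unfolding norm_V sum_norm_decoding_error[OF Q(1) assms(2,3) Q(2)] success by (simp add: N_def)
  finally have E: "(\<Sum>p\<in>UNIV. (cmod (f p - g p))\<^sup>2) = \<epsilon>" .

  \<comment> \<open>This supplies the bound by 1 on the weighted square sum of \<open>f\<close> that
    the perturbation estimate requires.\<close>
  have "(\<Sum>y\<in>UNIV. (cmod (P y))\<^sup>2 * relative_agreement y) \<le> (\<Sum>y\<in>UNIV. (cmod (P y))\<^sup>2)"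
    by (intro sum_mono mult_left_le relative_agreement_bounds) simp
  then have "(\<Sum>y\<in>UNIV. (cmod (P y))\<^sup>2 * relative_agreement y) - 2 * sqrt \<epsilon>
      \<le> (\<Sum>p\<in>UNIV. w p * (cmod (g p))\<^sup>2)"
    unfolding F[symmetric] using E assms(1) relative_agreement_bounds
    by (intro weighted_square_sum_perturbation) (auto simp: w_def F)
  also note G
  \<comment> \<open>\<open>N\<close> is the number of vectors \<open>v\<close>, so the sum is the
    expectation over uniform \<open>v\<close>.\<close>
  also have "(\<Sum>v\<in>UNIV. measure_pmf.expectation (?out v) (\<lambda>c. relative_agreement (c - v)) / N)
      = measure_pmf.expectation
      (do { v \<leftarrow> pmf_of_set UNIV; c \<leftarrow> ?out v; return_pmf (v, c) })
      (\<lambda>(v, c). relative_agreement (c - v))"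
    by (subst pmf_expectation_bind_pmf_of_set)
      (simp_all add: map_pmf_def[symmetric] card_bit_vec N_def divide_inverse mult.commute
        del: CARD_vec)
  finally show "measure_pmf.expectation
      (do { v \<leftarrow> pmf_of_set UNIV; c \<leftarrow> ?out v; return_pmf (v, c) })
      (\<lambda>(v, c). 1 - real (hamming_weight (c - v)) / real CARD('m))
    \<ge> (\<Sum>y\<in>UNIV. (cmod (P y))\<^sup>2 * (1 - real (hamming_weight y) / real CARD('m))) - 2 * sqrt \<epsilon>"
    unfolding relative_agreement_def .
qed

end
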